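(* Let $N\ge2$ be an integer and let $$T(x)=\sum_{k=0}^\infty\frac1{N^k}\,\mathrm{Dist}(N^kx,\mathbb{Z}),\qquad x\in[0,1],$$ be the classical Takagi function, with graph $\Gamma_T=\{(x,T(x)):x\in[0,1]\}$. Then $\dim_A^\theta(\Gamma_T)=1$ for every $\theta\in(0,1)$, and consequently the quasi-Assouad dimension satisfies $\dim_{qA}(\Gamma_T)=1$.
   Context: $\mathrm{Dist}(x,\mathbb{Z})$ is the distance from $x$ to the nearest integer. For a bounded set $E\subset\mathbb{R}^n$ and $r>0$, $N_r(E)$ is the minimum number of open balls of radius $r$ needed to cover $E$. For $\theta\in(0,1)$ the Assouad spectrum of $F$ is $$\dim_A^\theta(F)=\inf\Big\{s:\ \exists C>0\ \forall\, 0<R<1\ \forall x\in F,\ N_{R^{1/\theta}}(B(x,R)\cap F)\le C\Big(\frac{R}{R^{1/\theta}}\Big)^{s}\Big\},$$ and the quasi-Assouad dimension is $\dim_{qA}(F)=\lim_{\theta\to1}\dim_A^\theta(F)$. *)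

theory Defs
  imports "HOL-Analysis.Analysis"
begin

(* The centres of the covering balls range over the whole ambient space. In a Euclidean
   space every bounded E has such a finite cover when r > 0, so the LEAST is attained. *)
definition covering_number :: "real \<Rightarrow> 'a::euclidean_space set \<Rightarrow> nat" where
  "covering_number r E = (LEAST n. \<exists>C. finite C \<and> card C = n \<and> E \<subseteq> (\<Union>c\<in>C. ball c r))"

(* The infimum is taken in the extended reals, so it is meaningful without first showing
   that the set of admissible exponents is nonempty and bounded below. *)
definition assouad_spectrum :: "real \<Rightarrow> 'a::euclidean_space set \<Rightarrow> ereal" where
  "assouad_spectrum \<theta> F =
    Inf {ereal s | s. \<exists>C>0. \<forall>R. 0 < R \<and> R < 1 \<longrightarrow> (\<forall>x\<in>F.
      real (covering_number (R powr (1 / \<theta>)) (ball x R \<inter> F))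
        \<le> C * (R / R powr (1 / \<theta>)) powr s)}"

definition quasi_assouad_dim :: "'a::euclidean_space set \<Rightarrow> ereal" where
  "quasi_assouad_dim F = Lim (at_left 1) (\<lambda>\<theta>. assouad_spectrum \<theta> F)"

definition takagi :: "nat \<Rightarrow> real \<Rightarrow> real" where
  "takagi N x = (\<Sum>k. 1 / real N ^ k * infdist (real N ^ k * x) \<int>)"

(* The product type real * real carries the Euclidean (L2) metric. *)
definition takagi_graph :: "nat \<Rightarrow> (real \<times> real) set" where
  "takagi_graph N = (\<lambda>x. (x, takagi N x)) ` {0..1}"

end

theory Submission
  imports Defs
begin

(* The summands of T give |T x - T y| \<le> (sum of N^{-k} min(1, N^k |x - y|)), so T is
   a-Hoelder for every a < 1.  This alone determines the spectrum: with r = R^{1/\<theta>}, the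
   graph over an interval of length r has height O(r^a), so a ball of radius R needs
   O((R/r) r^{a-1}) balls of radius r, and r^{a-1} = (R/r)^{(1-a)/(1-\<theta>)} is an arbitrarily
   small power of R/r.  Conversely, the part of the graph in a ball of radius R projects onto
   an interval of length comparable to R^{1/a}, which needs about R^{1/a}/r balls. *)

section \<open>Covering numbers and their lower bound by projected length\<close>

lemma covering_number_le_card:
  assumes "finite C" "E \<subseteq> (\<Union>c\<in>C. ball c r)"
  shows "covering_number r E \<le> card C"
proof -
  have "\<exists>C'. finite C' \<and> card C' = card C \<and> E \<subseteq> (\<Union>c\<in>C'. ball c r)"
    using assms by blast
  then show ?thesis
    unfolding covering_number_def by (rule Least_le)
qed

text \<open>The compact closure is totally bounded, so some finite cover exists and the
  \<open>LEAST\<close> is a genuine minimum; otherwise it would carry no information.\<close>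

lemma covering_number_attained:
  fixes E :: "'a::euclidean_space set"
  assumes "bounded E" "r > 0"
  obtains C where "finite C" "card C = covering_number r E" "E \<subseteq> (\<Union>c\<in>C. ball c r)"
proof -
  have "compact (closure E)"
    using assms by simp
  then obtain C where "finite C" "closure E \<subseteq> (\<Union>c\<in>C. ball c r)"
    using \<open>r > 0\<close> unfolding compact_eq_totally_bounded by meson
  then have "\<exists>n C. finite C \<and> card C = n \<and> E \<subseteq> (\<Union>c\<in>C. ball c r)"
    using closure_subset by (metis subset_trans)
  then have "\<exists>C. finite C \<and> card C = covering_number r E \<and> E \<subseteq> (\<Union>c\<in>C. ball c r)"
    unfolding covering_number_def by (rule LeastI_ex)
  then show ?thesis
    using that by blast
qed

text \<open>Projection to the first coordinate does not increase distances, so each ball of radius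
  \<open>r\<close> has its shadow in an interval of length \<open>2 * r\<close>; subadditivity of
  Lebesgue measure does the rest.\<close>

lemma length_le_covering_number:
  fixes E :: "(real \<times> real) set"
  assumes "bounded E" "r > 0" "{u..v} \<subseteq> fst ` E" "u \<le> v"
  shows "v - u \<le> 2 * r * real (covering_number r E)"
proof -
  obtain C where C: "finite C" "card C = covering_number r E" "E \<subseteq> (\<Union>c\<in>C. ball c r)"
    using covering_number_attained[OF assms(1,2)] by blast
  have "fst ` ball c r \<subseteq> {fst c - r..fst c + r}" for c :: "real \<times> real"
  proof
    fix y assume "y \<in> fst ` ball c r"
    then obtain z where "y = fst z" "dist c z < r" by auto
    then show "y \<in> {fst c - r..fst c + r}"
      using dist_fst_le[of c z] by (auto simp: dist_real_def abs_le_iff)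
  qed
  then have sub: "{u..v} \<subseteq> (\<Union>c\<in>C. {fst c - r..fst c + r})"
    using order_trans[OF assms(3) image_mono[OF C(3)]] unfolding image_UN
    by (meson UN_mono order_refl order_trans)
  have "v - u = measure lborel {u..v}"
    using \<open>u \<le> v\<close> by simp
  also have "\<dots> \<le> measure lborel (\<Union>c\<in>C. {fst c - r..fst c + r})"
  proof (rule measure_mono_fmeasurable[OF sub])
    show "(\<Union>c\<in>C. {fst c - r..fst c + r}) \<in> fmeasurable lborel"
      using C(1) by (intro fmeasurable.finite_UN) (simp_all add: fmeasurable_def emeasure_lborel_Icc_eq)
  qed simp
  also have "\<dots> \<le> (\<Sum>c\<in>C. measure lborel {fst c - r..fst c + r})"
    using C(1) by (rule measure_UNION_le) simp
  also have "\<dots> = 2 * r * real (card C)"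
    using \<open>r > 0\<close> by simp
  finally show ?thesis
    using C(2) by simp
qed

section \<open>Spectrum of a graph that is Hoelder for every exponent below 1\<close>

lemma card_int_interval_le:
  fixes X :: real
  assumes "X \<ge> 0"
  shows "real (card {- \<lfloor>X\<rfloor>..\<lfloor>X\<rfloor>}) \<le> 2 * X + 1"
proof -
  have "real (card {- \<lfloor>X\<rfloor>..\<lfloor>X\<rfloor>}) = 2 * real_of_int \<lfloor>X\<rfloor> + 1"
    using assms by simp
  then show ?thesis
    by linarith
qed

text \<open>Rounding down to a multiple of \<open>h\<close>. The \<open>+ 1\<close> in the index
  range is for negative \<open>d\<close>, where the floor can fall below \<open>- A / h\<close>,
  though by less than 1.\<close>

lemma floor_grid:
  fixes d h A :: real
  assumes "h > 0" "\<bar>d\<bar> \<le> A"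
  shows "\<bar>d - \<lfloor>d / h\<rfloor> * h\<bar> < h" "\<lfloor>d / h\<rfloor> \<in> {- \<lfloor>A / h + 1\<rfloor>..\<lfloor>A / h + 1\<rfloor>}"
proof -
  have "d - \<lfloor>d / h\<rfloor> * h = (d / h - \<lfloor>d / h\<rfloor>) * h"
    using assms by (simp add: field_simps)
  moreover have "0 \<le> (d / h - \<lfloor>d / h\<rfloor>) * h" "(d / h - \<lfloor>d / h\<rfloor>) * h < 1 * h"
    using assms by (auto intro!: mult_nonneg_nonneg mult_strict_right_mono) linarith+
  ultimately show "\<bar>d - \<lfloor>d / h\<rfloor> * h\<bar> < h"
    by simp
  have "d / h \<le> A / h" "- (A / h) \<le> d / h"
    using assms by (auto simp: field_simps)
  moreover have "A / h \<le> of_int \<lfloor>A / h + 1\<rfloor>"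
    by linarith
  ultimately show "\<lfloor>d / h\<rfloor> \<in> {- \<lfloor>A / h + 1\<rfloor>..\<lfloor>A / h + 1\<rfloor>}"
    by (simp add: le_floor_iff) (linarith | simp)
qed

text \<open>The ball meets O(R/r) columns of width \<open>h\<close>. Within one column the graph
  stays within K r^a of its height at the node, so O(r^(a-1)) + O(1) vertically shifted centres
  suffice there.\<close>

lemma covering_number_holder_graph_le:
  fixes f :: "real \<Rightarrow> real"
  assumes f: "\<And>x y. \<bar>f x - f y\<bar> \<le> K * \<bar>x - y\<bar> powr a"
    and "K \<ge> 0" "a > 0" "0 < r" "R > 0"
  shows "real (covering_number r (ball (x0, f x0) R \<inter> (\<lambda>x. (x, f x)) ` S))
           \<le> (4 * (R / r) + 3) * (4 * K * r powr (a - 1) + 3)"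
proof -
  \<comment> \<open>The horizontal and the vertical rounding error are each below \<open>h\<close>,
    so together below \<open>r\<close>.\<close>
  define h where "h = r / 2"
  define I where "I = {- \<lfloor>R / h + 1\<rfloor>..\<lfloor>R / h + 1\<rfloor>}"
  define J where "J = {- \<lfloor>K * r powr a / h + 1\<rfloor>..\<lfloor>K * r powr a / h + 1\<rfloor>}"
  define c where "c = (\<lambda>(i::int, j::int). (x0 + i * h, f (x0 + i * h) + j * h))"
  have h: "h > 0" using \<open>r > 0\<close> by (simp add: h_def)
  have "ball (x0, f x0) R \<inter> (\<lambda>x. (x, f x)) ` S \<subseteq> (\<Union>p\<in>c ` (I \<times> J). ball p r)"
  proof
    fix p assume p: "p \<in> ball (x0, f x0) R \<inter> (\<lambda>x. (x, f x)) ` S"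
    then obtain t where t: "p = (t, f t)" by auto
    define i where "i = \<lfloor>(t - x0) / h\<rfloor>"
    \<comment> \<open>The node \<open>u\<close> may lie outside \<open>S\<close>; the Hoelder bound
      on the whole line still allows \<open>f u\<close> as reference height.\<close>
    define u where "u = x0 + i * h"
    define j where "j = \<lfloor>(f t - f u) / h\<rfloor>"
    have "\<bar>t - x0\<bar> \<le> R"
      using dist_fst_le[of "(x0, f x0)" p] p t by (simp add: dist_real_def abs_minus_commute)
    then have "\<bar>t - x0 - i * h\<bar> < h" and i: "i \<in> I"
      using floor_grid[of h "t - x0" R] h by (auto simp: i_def I_def)
    then have tu: "\<bar>t - u\<bar> < h"
      by (simp add: u_def algebra_simps)
    have "\<bar>f t - f u\<bar> \<le> K * \<bar>t - u\<bar> powr a"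
      by (rule f)
    also have "\<dots> \<le> K * r powr a"
      using tu \<open>K \<ge> 0\<close> \<open>a > 0\<close> \<open>r > 0\<close>
      by (intro mult_left_mono powr_mono2) (auto simp: h_def)
    finally have fu: "\<bar>f t - f u - j * h\<bar> < h" and j: "j \<in> J"
      using floor_grid[of h "f t - f u" "K * r powr a"] h by (auto simp: j_def J_def)
    have "dist (c (i, j)) p = norm (u - t, f u + j * h - f t)"
      by (simp add: c_def t dist_norm u_def)
    also have "\<dots> \<le> \<bar>u - t\<bar> + \<bar>f u + j * h - f t\<bar>"
      using norm_Pair_le[of "u - t" "f u + j * h - f t"] by simp
    also have "\<dots> < h + h"
      using tu fu by linarith
    also have "\<dots> = r" by (simp add: h_def)
    finally show "p \<in> (\<Union>p\<in>c ` (I \<times> J). ball p r)"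
      using i j by auto
  qed
  then have "covering_number r (ball (x0, f x0) R \<inter> (\<lambda>x. (x, f x)) ` S) \<le> card (c ` (I \<times> J))"
    by (intro covering_number_le_card) (auto simp: I_def J_def)
  also have "\<dots> \<le> card (I \<times> J)"
    by (rule card_image_le) (auto simp: I_def J_def)
  also have "\<dots> = card I * card J"
    by (rule card_cartesian_product)
  finally have "real (covering_number r (ball (x0, f x0) R \<inter> (\<lambda>x. (x, f x)) ` S))
      \<le> real (card I) * real (card J)"
    by (metis of_nat_le_iff of_nat_mult)
  also have "\<dots> \<le> (2 * (R / h + 1) + 1) * (2 * (K * r powr a / h + 1) + 1)"
    unfolding I_def J_def using h assms
    by (intro mult_mono card_int_interval_le) auto
  also have "\<dots> = (4 * (R / r) + 3) * (4 * K * r powr (a - 1) + 3)"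
    using \<open>r > 0\<close> by (simp add: h_def powr_diff field_simps)
  finally show ?thesis .
qed

text \<open>Every exponent 1 + e is admissible: since R/r = r^(\<theta>-1), the excess factor
  r^(a-1) can be made equal to (R/r)^e.\<close>

lemma assouad_spectrum_holder_graph_le:
  fixes f :: "real \<Rightarrow> real"
  assumes f: "\<And>a. 0 < a \<Longrightarrow> a < 1 \<Longrightarrow> \<exists>K\<ge>0. \<forall>x y. \<bar>f x - f y\<bar> \<le> K * \<bar>x - y\<bar> powr a"
    and \<theta>: "0 < \<theta>" "\<theta> < 1"
  shows "assouad_spectrum \<theta> ((\<lambda>x. (x, f x)) ` S) \<le> 1"
proof -
  have le: "assouad_spectrum \<theta> ((\<lambda>x. (x, f x)) ` S) \<le> ereal (1 + e)" if e: "0 < e" "e < 1" for e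
  proof -
    \<comment> \<open>The solution of r^(a-1) = (R/r)^e; here e < 1 ensures a > 0.\<close>
    define a where "a = 1 - e * (1 - \<theta>)"
    have "e * (1 - \<theta>) < 1 * 1"
      using e \<theta> by (intro mult_strict_mono) auto
    moreover have "0 < e * (1 - \<theta>)"
      using e \<theta> by simp
    ultimately have a: "0 < a" "a < 1" by (auto simp: a_def)
    obtain K where K: "K \<ge> 0" "\<And>x y. \<bar>f x - f y\<bar> \<le> K * \<bar>x - y\<bar> powr a"
      using f[OF a] by blast
    \<comment> \<open>As R/r and r^(a-1) are at least 1, the additive constants 3 are absorbed: 4X +
      3 \<le> 7X and 4KY + 3 \<le> (4K + 3)Y.\<close>
    define C where "C = 7 * (4 * K + 3)"
    have "real (covering_number (R powr (1 / \<theta>)) (ball p R \<inter> (\<lambda>x. (x, f x)) ` S))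
            \<le> C * (R / R powr (1 / \<theta>)) powr (1 + e)"
      if R: "0 < R" "R < 1" and p: "p \<in> (\<lambda>x. (x, f x)) ` S" for R p
    proof -
      define r where "r = R powr (1 / \<theta>)"
      have "r \<le> R powr 1"
        unfolding r_def using R \<theta> by (intro powr_mono') auto
      then have r: "0 < r" "r \<le> R"
        using R by (auto simp: r_def)
      have Rr: "R / r \<ge> 1"
        using r by simp
      then have lin: "4 * (R / r) + 3 \<le> 7 * (R / r)"
        by linarith
      have "R / r = R powr (1 - 1 / \<theta>)"
        using R by (simp add: r_def powr_diff)
      moreover have "(1 - 1 / \<theta>) * e = 1 / \<theta> * (a - 1)"
        using \<theta> by (simp add: a_def field_simps)
      ultimately have eq: "(R / r) powr e = r powr (a - 1)"
        by (simp add: r_def powr_powr)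
      have ge: "r powr (a - 1) \<ge> 1"
        using Rr e by (simp flip: eq add: ge_one_powr_ge_zero)
      obtain x0 where "p = (x0, f x0)" using p by auto
      then have "real (covering_number r (ball p R \<inter> (\<lambda>x. (x, f x)) ` S))
          \<le> (4 * (R / r) + 3) * (4 * K * r powr (a - 1) + 3)"
        using covering_number_holder_graph_le[OF K(2,1) a(1) r(1) R(1)] by simp
      also have "\<dots> \<le> (7 * (R / r)) * ((4 * K + 3) * r powr (a - 1))"
        using ge K(1) R r by (intro mult_mono[OF lin]) (simp_all add: algebra_simps)
      also have "\<dots> = C * ((R / r) * (R / r) powr e)"
        by (simp add: C_def eq)
      also have "(R / r) * (R / r) powr e = (R / r) powr (1 + e)"
        using R r by (simp add: powr_add)
      finally show ?thesis
        by (simp add: r_def)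
    qed
    moreover have "C > 0" using K(1) by (simp add: C_def)
    ultimately show ?thesis
      unfolding assouad_spectrum_def by (intro Inf_lower) blast
  qed
  have "assouad_spectrum \<theta> ((\<lambda>x. (x, f x)) ` S) \<le> 1 + ereal e" if "0 < e" for e
  proof -
    have "assouad_spectrum \<theta> ((\<lambda>x. (x, f x)) ` S) \<le> ereal (1 + min e (1/2))"
      using that by (intro le) auto
    also have "\<dots> \<le> ereal (1 + e)" by simp
    finally show ?thesis by (simp add: one_ereal_def)
  qed
  then show ?thesis
    by (rule ereal_le_epsilon2)
qed

text \<open>An admissible s < 1 would force R^b \<le> const * R^q for all R in (0,1) with some b <
  q, which fails as R tends to 0. The balls are centred at the left endpoint of the graph.\<close>

lemma assouad_spectrum_holder_graph_ge:
  fixes f :: "real \<Rightarrow> real"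
  assumes f: "\<And>a. 0 < a \<Longrightarrow> a < 1 \<Longrightarrow> \<exists>K\<ge>0. \<forall>x y. \<bar>f x - f y\<bar> \<le> K * \<bar>x - y\<bar> powr a"
    and \<theta>: "0 < \<theta>" "\<theta> < 1"
  shows "assouad_spectrum \<theta> ((\<lambda>x. (x, f x)) ` {0..1}) \<ge> 1"
proof -
  let ?\<Gamma> = "(\<lambda>x. (x, f x)) ` {0..1}"
  have "1 \<le> s"
    if "C > 0" and C: "\<And>R x. 0 < R \<Longrightarrow> R < 1 \<Longrightarrow> x \<in> ?\<Gamma> \<Longrightarrow>
      real (covering_number (R powr (1 / \<theta>)) (ball x R \<inter> ?\<Gamma>)) \<le> C * (R / R powr (1 / \<theta>)) powr s"
    for C s
  proof (rule ccontr)
    assume "\<not> 1 \<le> s"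
    \<comment> \<open>The exponent with r (R/r)^s = R^q; it exceeds 1 exactly when s < 1.\<close>
    define q where "q = 1 / \<theta> + (1 - 1 / \<theta>) * s"
    have "q - 1 = (1 / \<theta> - 1) * (1 - s)"
      using \<theta> by (simp add: q_def field_simps)
    moreover have "(1 / \<theta> - 1) * (1 - s) > 0"
      using \<theta> \<open>\<not> 1 \<le> s\<close> by (intro mult_pos_pos) auto
    ultimately have "q > 1" by simp
    \<comment> \<open>Any value strictly between 1 and \<open>q\<close> serves: b > 1 makes 1/b an
      allowed Hoelder exponent, and b < q gives the contradiction.\<close>
    define b where "b = (1 + q) / 2"
    have b: "1 < b" "b < q" using \<open>q > 1\<close> by (auto simp: b_def)
    define a where "a = 1 / b"
    have a: "0 < a" "a < 1" using b by (auto simp: a_def)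
    obtain K where K: "K \<ge> 0" "\<And>x y. \<bar>f x - f y\<bar> \<le> K * \<bar>x - y\<bar> powr a"
      using f[OF a] by blast
    have key: "R powr (q - b) \<ge> 1 / (2 * C * (K + 2) powr b)" if R: "0 < R" "R < 1" for R
    proof -
      define r where "r = R powr (1 / \<theta>)"
      \<comment> \<open>Thus \<delta>^a = R/(K+2). For t \<le> \<delta> \<le> 1 the displacement is
        at most t + K t^a \<le> (K+1) t^a; taking K+2 instead of K+1 makes it strictly less than R,
        as the open ball demands.\<close>
      define \<delta> where "\<delta> = (R / (K + 2)) powr b"
      have RK: "0 < R / (K + 2)" "R / (K + 2) < 1"
        using R K(1) by auto
      have \<delta>: "0 < \<delta>" "\<delta> \<le> 1"
        using RK b K(1) R powr_mono2[of b "R / (K + 2)" 1] by (auto simp: \<delta>_def)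
      have "{0..\<delta>} \<subseteq> fst ` (ball (0, f 0) R \<inter> ?\<Gamma>)"
      proof
        fix t assume t: "t \<in> {0..\<delta>}"
        have "t powr a \<le> \<delta> powr a"
          using t a by (intro powr_mono2) auto
        also have "\<dots> = R / (K + 2)"
          unfolding \<delta>_def a_def powr_powr using RK b K(1) R by simp
        finally have ta: "t powr a \<le> R / (K + 2)" .
        have "t \<le> t powr a"
          using powr_mono'[of a 1 t] t \<delta> a by simp
        have "dist (0, f 0) (t, f t) \<le> \<bar>t\<bar> + \<bar>f 0 - f t\<bar>"
          using norm_Pair_le[of "0 - t" "f 0 - f t"] by (simp add: dist_norm)
        also have "\<dots> \<le> t powr a + K * t powr a"
          using \<open>t \<le> t powr a\<close> K(2)[of 0 t] t by simp
        also have "\<dots> = (K + 1) * t powr a"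
          by (simp add: algebra_simps)
        also have "\<dots> \<le> (K + 1) * (R / (K + 2))"
          using ta K(1) by (intro mult_left_mono) auto
        also have "\<dots> < (K + 2) * (R / (K + 2))"
          using RK by (intro mult_strict_right_mono) auto
        also have "\<dots> = R" using K(1) by simp
        finally have "(t, f t) \<in> ball (0, f 0) R \<inter> ?\<Gamma>"
          using t \<delta> by auto
        then show "t \<in> fst ` (ball (0, f 0) R \<inter> ?\<Gamma>)"
          by force
      qed
      then have "\<delta> - 0 \<le> 2 * r * real (covering_number r (ball (0, f 0) R \<inter> ?\<Gamma>))"
        using R \<delta> by (intro length_le_covering_number) (auto simp: r_def bounded_Int)
      also have "\<dots> \<le> 2 * r * (C * (R / r) powr s)"
        unfolding r_def using R by (intro mult_left_mono C) auto
      also have "r * (R / r) powr s = R powr q"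
      proof -
        have "R / r = R powr (1 - 1 / \<theta>)"
          using R by (simp add: r_def powr_diff)
        then show ?thesis
          by (simp add: r_def powr_powr powr_add q_def)
      qed
      then have "2 * r * (C * (R / r) powr s) = 2 * C * R powr q" by simp
      finally have "R powr b / (K + 2) powr b \<le> 2 * C * R powr q"
        using R K(1) by (simp add: \<delta>_def powr_divide)
      then show ?thesis
        using R K(1) \<open>C > 0\<close> by (simp add: powr_diff field_simps)
    qed
    \<comment> \<open>By \<open>key\<close>, \<open>m\<close> is a positive lower bound of R^(q-b)
      on (0,1), yet this power tends to 0.\<close>
    define m where "m = 1 / (2 * C * (K + 2) powr b)"
    have "m > 0" using \<open>C > 0\<close> K(1) by (simp add: m_def)
    have "((\<lambda>R. R powr (q - b)) \<longlongrightarrow> 0) (at_right 0)"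
      using b by (auto intro!: tendsto_eq_intros filterlim_ident simp: eventually_at_right_less eventually_at_filter)
    then have "\<forall>\<^sub>F R in at_right 0. R powr (q - b) < m"
      using \<open>m > 0\<close> by (rule order_tendstoD)
    moreover have "\<forall>\<^sub>F R in at_right (0::real). R \<in> {0<..<1}"
      by (rule eventually_at_right_real) simp
    ultimately have "\<forall>\<^sub>F R in at_right (0::real). False"
      by eventually_elim (use key m_def in \<open>simp add: leD\<close>)
    then show False by simp
  qed
  then show ?thesis
    unfolding assouad_spectrum_def one_ereal_def
    by (intro Inf_greatest) force
qed

section \<open>Hoelder continuity of the Takagi function\<close>

lemma infdist_Ints_le_1: "infdist (x::real) \<int> \<le> 1"
proof -
  have "infdist x \<int> \<le> dist x (of_int \<lfloor>x\<rfloor>)"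
    by (intro infdist_le) auto
  also have "\<dots> \<le> 1"
    unfolding dist_real_def by linarith
  finally show ?thesis .
qed

text \<open>The distance to the integers is 1-Lipschitz and takes values in [0,1], and min(1,t)
  \<le> t^a for t \<ge> 0.\<close>

lemma infdist_Ints_holder:
  fixes x y :: real
  assumes "0 < a" "a < 1"
  shows "\<bar>infdist x \<int> - infdist y \<int>\<bar> \<le> \<bar>x - y\<bar> powr a"
proof (cases "\<bar>x - y\<bar> \<le> 1")
  case True
  have "\<bar>infdist x \<int> - infdist y \<int>\<bar> \<le> \<bar>x - y\<bar>"
    using infdist_triangle_abs[of x \<int> y] by (simp add: dist_real_def)
  also have "\<dots> \<le> \<bar>x - y\<bar> powr a"
    using powr_mono'[of a 1 "\<bar>x - y\<bar>"] True assms by simp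
  finally show ?thesis .
next
  case False
  have "\<bar>infdist x \<int> - infdist y \<int>\<bar> \<le> 1"
    using infdist_Ints_le_1[of x] infdist_Ints_le_1[of y] infdist_nonneg[of x \<int>]
      infdist_nonneg[of y \<int>] by linarith
  also have "\<dots> \<le> \<bar>x - y\<bar> powr a"
    using False assms by (intro ge_one_powr_ge_zero) auto
  finally show ?thesis .
qed

text \<open>In the k-th term the dilation costs N^(ka) and the weight gains N^(-k), leaving the
  ratio \<rho> = N^(a-1) < 1; the geometric sum gives K = 1/(1-\<rho>).\<close>

lemma takagi_holder:
  assumes N: "N \<ge> 2" and a: "0 < a" "a < 1"
  shows "\<exists>K\<ge>0. \<forall>x y. \<bar>takagi N x - takagi N y\<bar> \<le> K * \<bar>x - y\<bar> powr a"
proof -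
  define \<rho> where "\<rho> = real N powr (a - 1)"
  have "\<rho> < real N powr 0"
    unfolding \<rho>_def using N a by (intro powr_less_mono) auto
  then have \<rho>: "0 \<le> \<rho>" "\<rho> < 1" using N by (auto simp: \<rho>_def)
  \<comment> \<open>Convergence of both series is what permits subtracting them termwise.\<close>
  have summ: "summable (\<lambda>k. 1 / real N ^ k * infdist (real N ^ k * x) \<int>)" for x
  proof (rule summable_comparison_test[OF exI, OF allI, OF impI])
    show "summable (\<lambda>k. (1 / real N) ^ k)"
      using N by (intro summable_geometric) auto
    show "norm (1 / real N ^ k * infdist (real N ^ k * x) \<int>) \<le> (1 / real N) ^ k" for k
      using infdist_Ints_le_1[of "real N ^ k * x"] infdist_nonneg[of "real N ^ k * x" \<int>]
      by (simp add: power_one_over divide_right_mono)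
  qed
  have "\<bar>takagi N x - takagi N y\<bar> \<le> (1 / (1 - \<rho>)) * \<bar>x - y\<bar> powr a" for x y
  proof -
    let ?d = "\<lambda>k. 1 / real N ^ k * infdist (real N ^ k * x) \<int> - 1 / real N ^ k * infdist (real N ^ k * y) \<int>"
    have d_le: "norm (?d k) \<le> \<rho> ^ k * \<bar>x - y\<bar> powr a" for k
    proof -
      have "norm (?d k) = \<bar>infdist (real N ^ k * x) \<int> - infdist (real N ^ k * y) \<int>\<bar> / real N ^ k"
        by (simp add: abs_div_pos N flip: diff_divide_distrib)
      also have "\<dots> \<le> \<bar>real N ^ k * x - real N ^ k * y\<bar> powr a / real N ^ k"
        using infdist_Ints_holder[OF a] by (intro divide_right_mono) auto
      also have "\<bar>real N ^ k * x - real N ^ k * y\<bar> = real N ^ k * \<bar>x - y\<bar>"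
        by (simp add: abs_mult flip: right_diff_distrib)
      also have "(real N ^ k * \<bar>x - y\<bar>) powr a / real N ^ k
          = (real N powr real k) powr a / real N powr real k * \<bar>x - y\<bar> powr a"
        using N by (simp add: powr_mult powr_realpow)
      also have "(real N powr real k) powr a / real N powr real k = \<rho> ^ k"
        using N by (simp add: \<rho>_def powr_powr powr_diff[symmetric] powr_realpow[symmetric] algebra_simps)
      finally show ?thesis .
    qed
    have geo: "(\<lambda>k. \<rho> ^ k * \<bar>x - y\<bar> powr a) sums (1 / (1 - \<rho>) * \<bar>x - y\<bar> powr a)"
      using \<rho> by (intro sums_mult2 geometric_sums) auto
    have "takagi N x - takagi N y = (\<Sum>k. ?d k)"
      unfolding takagi_def by (rule suminf_diff[OF summ summ])
    then have "\<bar>takagi N x - takagi N y\<bar> \<le> (\<Sum>k. \<rho> ^ k * \<bar>x - y\<bar> powr a)"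
      using norm_suminf_le[OF d_le sums_summable[OF geo]] by simp
    then show ?thesis
      using sums_unique[OF geo] by simp
  qed
  then show ?thesis
    using \<rho> by (intro exI[of _ "1 / (1 - \<rho>)"]) auto
qed

theorem mainTheorem7:
  fixes N :: nat
  assumes "N \<ge> 2"
  shows "(\<forall>\<theta>\<in>{0<..<1}. assouad_spectrum \<theta> (takagi_graph N) = 1) \<and>
         quasi_assouad_dim (takagi_graph N) = 1"
proof -
  have spec: "assouad_spectrum \<theta> (takagi_graph N) = 1" if "\<theta> \<in> {0<..<1}" for \<theta>
    unfolding takagi_graph_def using that takagi_holder[OF assms]
    by (intro antisym assouad_spectrum_holder_graph_le assouad_spectrum_holder_graph_ge) auto
  \<comment> \<open>Near 1 from the left the spectrum is constantly 1, so the limit exists and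
    \<open>Lim\<close> returns it.\<close>
  have "\<forall>\<^sub>F \<theta> in at_left (1::real). \<theta> \<in> {0<..<1}"
    by (rule eventually_at_left_real) simp
  then have "((\<lambda>\<theta>. assouad_spectrum \<theta> (takagi_graph N)) \<longlongrightarrow> 1) (at_left 1)"
    by (intro tendsto_eventually) (auto elim!: eventually_mono intro: spec)
  then have "quasi_assouad_dim (takagi_graph N) = 1"
    unfolding quasi_assouad_dim_def by (intro tendsto_Lim) auto
  with spec show ?thesis by blast
qed

end
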